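(* For every $n\ge 1$ and every $f:\{0,1\}^n\to\{0,1\}$, $C(f)\le \mathrm{EC}(f)^2$.
   Context: Let $f:\{0,1\}^n\to\{0,1\}$ and $[n]=\{1,\dots,n\}$. Certificate complexity: an assignment is a map $A:[n]\to\{0,1,*\}$, identified with the subcube $\{x: \forall i,\ x_i=A(i)\text{ or }A(i)=*\}$; its size is $|A|=|\{i:A(i)\ne *\}|$. A $b$-certificate for $f$ is an assignment $A$ such that $x\in A\Rightarrow f(x)=b$. $C(f,x)$ is the size of the smallest $f(x)$-certificate consistent with $x$ (i.e. with $x\in A$), and $C(f)=\max_x C(f,x)$. The expectational certificate complexity $\mathrm{EC}(f)$ is the optimal value of the following program over families $\{w_x\}_{x\in\{0,1\}^n}$, $w_x\in\mathbb R^n$: minimize $\max_{x}\sum_{i=1}^n w_x(i)$ subject to $\sum_{i:x_i\ne y_i} w_x(i)w_y(i)\ge 1$ for all $x,y$ with $f(x)\ne f(y)$, and $0\le w_x(i)\le 1$ for all $x\in\{0,1\}^n$, $i\in[n]$. *)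

theory Defs
  imports Complex_Main
begin

text \<open>
  A finite type \<open>'n\<close> plays the role of the index set \<open>[n]\<close>, so that \<open>n = card (UNIV :: 'n set) \<ge> 1\<close>
  is arbitrary. The cube \<open>{0,1}^n\<close> is \<open>'n \<Rightarrow> bool\<close>, and the values 0 and 1 are \<open>False\<close> and \<open>True\<close>.
  In an assignment, \<open>None\<close> stands for \<open>*\<close>.
\<close>

type_synonym 'n assignment = "'n \<Rightarrow> bool option"

definition subcube :: "'n assignment \<Rightarrow> ('n \<Rightarrow> bool) set" where
  "subcube A = {x. \<forall>i. A i = Some (x i) \<or> A i = None}"

definition assignment_size :: "'n assignment \<Rightarrow> nat" where
  "assignment_size A = card {i. A i \<noteq> None}"

definition is_certificate :: "(('n \<Rightarrow> bool) \<Rightarrow> bool) \<Rightarrow> bool \<Rightarrow> 'n assignment \<Rightarrow> bool" where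
  "is_certificate f b A \<longleftrightarrow> (\<forall>x\<in>subcube A. f x = b)"

definition certificate_complexity_at ::
    "(('n::finite \<Rightarrow> bool) \<Rightarrow> bool) \<Rightarrow> ('n \<Rightarrow> bool) \<Rightarrow> nat" where
  "certificate_complexity_at f x =
     Min {assignment_size A | A. is_certificate f (f x) A \<and> x \<in> subcube A}"

definition certificate_complexity :: "(('n::finite \<Rightarrow> bool) \<Rightarrow> bool) \<Rightarrow> nat" where
  "certificate_complexity f = Max (range (certificate_complexity_at f))"

definition EC_feasible ::
    "(('n::finite \<Rightarrow> bool) \<Rightarrow> bool) \<Rightarrow> (('n \<Rightarrow> bool) \<Rightarrow> 'n \<Rightarrow> real) \<Rightarrow> bool" where
  "EC_feasible f w \<longleftrightarrow>
     (\<forall>x y. f x \<noteq> f y \<longrightarrow> (\<Sum>i | x i \<noteq> y i. w x i * w y i) \<ge> 1) \<and>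
     (\<forall>x i. 0 \<le> w x i \<and> w x i \<le> 1)"

definition EC_objective :: "(('n::finite \<Rightarrow> bool) \<Rightarrow> 'n \<Rightarrow> real) \<Rightarrow> real" where
  "EC_objective w = Max (range (\<lambda>x. \<Sum>i\<in>UNIV. w x i))"

definition EC :: "(('n::finite \<Rightarrow> bool) \<Rightarrow> bool) \<Rightarrow> real" where
  "EC f = Inf (EC_objective ` {w. EC_feasible f w})"

text \<open>The sets whose minimum and infimum are taken are nonempty and, respectively, finite and
  bounded below, so neither operator takes an unspecified value.\<close>

lemma certificate_sizes_nonempty:
  "{assignment_size A | A. is_certificate f (f x) A \<and> x \<in> subcube A} \<noteq> {}"
proof -
  have "subcube (\<lambda>i. Some (x i)) = {x}"
    by (auto simp: subcube_def fun_eq_iff)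
  then have "is_certificate f (f x) (\<lambda>i. Some (x i)) \<and> x \<in> subcube (\<lambda>i. Some (x i))"
    by (simp add: is_certificate_def)
  then show ?thesis by blast
qed

lemma certificate_sizes_finite:
  fixes f :: "('n::finite \<Rightarrow> bool) \<Rightarrow> bool"
  shows "finite {assignment_size A | A. is_certificate f (f x) A \<and> x \<in> subcube A}"
  by simp

lemma EC_feasible_one: "EC_feasible f (\<lambda>x i. 1)"
proof -
  have "1 \<le> card {i. x i \<noteq> y i}" if "f x \<noteq> f y" for x y :: "'a \<Rightarrow> bool"
  proof -
    from that have "x \<noteq> y" by auto
    then have "{i. x i \<noteq> y i} \<noteq> {}" by (auto simp: fun_eq_iff)
    then have "card {i. x i \<noteq> y i} \<noteq> 0" by simp
    then show ?thesis by linarith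
  qed
  then show ?thesis by (simp add: EC_feasible_def)
qed

lemma EC_objective_nonneg:
  assumes "EC_feasible f w"
  shows "0 \<le> EC_objective w"
proof -
  have "0 \<le> (\<Sum>i\<in>UNIV. w x i)" for x
    using assms by (auto simp: EC_feasible_def intro: sum_nonneg)
  then show ?thesis
    by (auto simp: EC_objective_def Max_ge_iff)
qed

lemma EC_values_bdd_below: "bdd_below (EC_objective ` {w. EC_feasible f w})"
  using EC_objective_nonneg by (intro bdd_belowI[where m = 0]) auto

lemma EC_values_nonempty: "EC_objective ` {w. EC_feasible f w} \<noteq> {}"
  using EC_feasible_one by blast

end

(* For a feasible w, let W bound every row sum. If f flips under a set B of coordinates of x, the
   constraint between x and its neighbour gives B weight at least 1 under w x. If B is minimal, the
   flipped point y is sensitive at every coordinate of B, which forces w y = 1 on B, so card B is at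
   most W. Hence minimal sensitive blocks satisfy card B \<le> W * (weight of B under w x), and a largest
   set U with this property meets every sensitive block of x (otherwise it could be enlarged by a
   minimal one), so it is the support of a certificate of size at most W * W. *)

theory Submission
  imports Defs
begin

text \<open>Inequality of booleans is exclusive or, so every point of the cube is
  \<open>flip x B\<close> for exactly one \<open>B\<close>.\<close>

definition flip :: "('n \<Rightarrow> bool) \<Rightarrow> 'n set \<Rightarrow> 'n \<Rightarrow> bool" where
  "flip x B = (\<lambda>i. x i \<noteq> (i \<in> B))"

lemma flip_differing: "{i. x i \<noteq> flip x B i} = B"
  by (auto simp: flip_def)

lemma flip_differing_set: "flip x {i. x i \<noteq> y i} = y"
  by (auto simp: flip_def fun_eq_iff)

lemma flip_empty [simp]: "flip x {} = x"
  by (simp add: flip_def)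

lemma flip_remove:
  assumes "i \<in> B"
  shows "flip (flip x B) {i} = flip x (B - {i})"
  using assms by (auto simp: flip_def fun_eq_iff)

lemma EC_feasible_flip:
  assumes "EC_feasible f w" "f (flip x B) \<noteq> f x"
  shows "1 \<le> (\<Sum>i\<in>B. w x i * w (flip x B) i)"
proof -
  have "1 \<le> (\<Sum>i | x i \<noteq> flip x B i. w x i * w (flip x B) i)"
    using assms by (metis EC_feasible_def)
  then show ?thesis by (simp only: flip_differing)
qed

text \<open>Entries of \<open>w\<close> are at most 1, so dropping the factor
  \<open>w (flip x B) i\<close> can only increase the sum in the feasibility constraint.\<close>

lemma sensitive_block_weight:
  assumes "EC_feasible f w" "f (flip x B) \<noteq> f x"
  shows "1 \<le> (\<Sum>i\<in>B. w x i)"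
proof -
  have "(\<Sum>i\<in>B. w x i * w (flip x B) i) \<le> (\<Sum>i\<in>B. w x i)"
    using assms(1) by (auto simp: EC_feasible_def intro!: sum_mono mult_left_le)
  then show ?thesis using EC_feasible_flip[OF assms] by linarith
qed

lemma row_sum_le_EC_objective: "(\<Sum>i\<in>UNIV. w x i) \<le> EC_objective w"
  by (auto simp: EC_objective_def)

lemma subset_sum_le_EC_objective:
  assumes "EC_feasible f w"
  shows "(\<Sum>i\<in>B. w x i) \<le> EC_objective w"
proof -
  have "(\<Sum>i\<in>B. w x i) \<le> (\<Sum>i\<in>UNIV. w x i)"
    using assms by (intro sum_mono2) (auto simp: EC_feasible_def)
  then show ?thesis using row_sum_le_EC_objective order_trans by blast
qed

lemma minimal_sensitive_block_card:
  assumes w: "EC_feasible f w"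
    and B: "f (flip x B) \<noteq> f x"
    and minimal: "\<And>B'. B' \<subset> B \<Longrightarrow> f (flip x B') = f x"
  shows "real (card B) \<le> EC_objective w"
proof -
  have "1 \<le> w (flip x B) i" if "i \<in> B" for i
  proof -
    \<comment> \<open>Flipping \<open>i\<close> back restores the value \<open>f x\<close> by
      minimality, so \<open>{i}\<close> is a sensitive block of \<open>flip x B\<close>, and its
      weight is a single entry.\<close>
    have "f (flip (flip x B) {i}) \<noteq> f (flip x B)"
      using that B minimal[of "B - {i}"] by (auto simp: flip_remove)
    from sensitive_block_weight[OF w this] show ?thesis by simp
  qed
  then have "(\<Sum>i\<in>B. 1) \<le> (\<Sum>i\<in>B. w (flip x B) i)"
    by (intro sum_mono)
  then show ?thesis
    using subset_sum_le_EC_objective[OF w, of "flip x B" B] by simp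
qed

lemma obtain_minimal_sensitive_block:
  fixes B :: "'n::finite set"
  assumes "f (flip x B) \<noteq> f x"
  obtains M where "M \<subseteq> B" "f (flip x M) \<noteq> f x" "\<And>B'. B' \<subset> M \<Longrightarrow> f (flip x B') = f x"
proof -
  let ?S = "{M. M \<subseteq> B \<and> f (flip x M) \<noteq> f x}"
  obtain M where "M \<in> ?S" "\<And>B'. B' \<in> ?S \<Longrightarrow> B' \<subseteq> M \<Longrightarrow> M = B'"
    using assms finite_has_minimal2[of ?S B] by auto
  then show thesis using that[of M] by blast
qed

lemma hitting_set_exists:
  fixes f :: "('n::finite \<Rightarrow> bool) \<Rightarrow> bool"
  assumes w: "EC_feasible f w"
  obtains U where "real (card U) \<le> (EC_objective w)\<^sup>2"
    and "\<And>B. f (flip x B) \<noteq> f x \<Longrightarrow> B \<inter> U \<noteq> {}"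
proof -
  define W where "W = EC_objective w"
  have W0: "0 \<le> W" using EC_objective_nonneg[OF w] by (simp add: W_def)
  \<comment> \<open>Both sides of this inequality are additive over disjoint unions, so a maximal
    member stands in for a greedily built packing of disjoint minimal blocks.\<close>
  let ?S = "{U. real (card U) \<le> W * (\<Sum>i\<in>U. w x i)}"
  have "{} \<in> ?S" by simp
  then obtain U where U: "U \<in> ?S" and maximal: "\<And>V. V \<in> ?S \<Longrightarrow> U \<subseteq> V \<Longrightarrow> U = V"
    using finite_has_maximal2[of ?S "{}"] by auto
  show thesis
  proof
    have "W * (\<Sum>i\<in>U. w x i) \<le> W * W"
      using subset_sum_le_EC_objective[OF w, of x U] W0 by (simp add: W_def mult_left_mono)
    then show "real (card U) \<le> (EC_objective w)\<^sup>2"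
      using U by (simp add: W_def power2_eq_square)
  next
    fix B assume "f (flip x B) \<noteq> f x"
    then obtain M where M: "M \<subseteq> B" "f (flip x M) \<noteq> f x"
        and minimal: "\<And>B'. B' \<subset> M \<Longrightarrow> f (flip x B') = f x"
      by (rule obtain_minimal_sensitive_block) blast
    \<comment> \<open>The empty block flips nothing, so it is not sensitive; hence adding
      \<open>M\<close> to a disjoint \<open>U\<close> enlarges it strictly.\<close>
    have "M \<noteq> {}" using M(2) by auto
    show "B \<inter> U \<noteq> {}"
    proof
      assume "B \<inter> U = {}"
      then have disjoint: "U \<inter> M = {}" using M(1) by blast
      have "real (card M) \<le> W"
        using minimal_sensitive_block_card[OF w M(2) minimal] by (simp add: W_def)
      also have "\<dots> \<le> W * (\<Sum>i\<in>M. w x i)"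
        using sensitive_block_weight[OF w M(2)] W0 by (simp add: mult_left_mono mult_le_cancel_left1)
      finally have "U \<union> M \<in> ?S"
        using U disjoint by (simp add: card_Un_disjoint sum.union_disjoint distrib_left)
      then show False using maximal[of "U \<union> M"] disjoint \<open>M \<noteq> {}\<close> by blast
    qed
  qed
qed

text \<open>Fixing \<open>x\<close> on \<open>U\<close> is a certificate: a point agreeing with
  \<open>x\<close> on \<open>U\<close> differs from it only on a block that misses \<open>U\<close>,
  which cannot be sensitive.\<close>

lemma certificate_complexity_at_le_hitting_set:
  fixes f :: "('n::finite \<Rightarrow> bool) \<Rightarrow> bool"
  assumes "\<And>B. f (flip x B) \<noteq> f x \<Longrightarrow> B \<inter> U \<noteq> {}"
  shows "certificate_complexity_at f x \<le> card U"
proof -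
  define A where "A = (\<lambda>i. if i \<in> U then Some (x i) else None)"
  have "f y = f x" if "y \<in> subcube A" for y
  proof (rule ccontr)
    assume "f y \<noteq> f x"
    then have "{i. x i \<noteq> y i} \<inter> U \<noteq> {}"
      by (intro assms) (simp only: flip_differing_set not_False_eq_True)
    then show False using that by (auto simp: subcube_def A_def split: if_splits)
  qed
  then have "is_certificate f (f x) A" by (simp add: is_certificate_def)
  moreover have "x \<in> subcube A" by (simp add: subcube_def A_def)
  ultimately have "certificate_complexity_at f x \<le> assignment_size A"
    unfolding certificate_complexity_at_def by (intro Min_le) auto
  also have "\<dots> = card U" by (simp add: assignment_size_def A_def)
  finally show ?thesis .
qed

lemma certificate_complexity_le_EC_objective_squared:
  assumes "EC_feasible f w"
  shows "real (certificate_complexity f) \<le> (EC_objective w)\<^sup>2"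
proof -
  have "certificate_complexity f \<in> range (certificate_complexity_at f)"
    unfolding certificate_complexity_def by (intro Max_in) auto
  then obtain x where x: "certificate_complexity f = certificate_complexity_at f x" by blast
  obtain U where "real (card U) \<le> (EC_objective w)\<^sup>2"
    and "\<And>B. f (flip x B) \<noteq> f x \<Longrightarrow> B \<inter> U \<noteq> {}"
    using hitting_set_exists[OF assms] by blast
  moreover from this(2) have "certificate_complexity_at f x \<le> card U"
    by (rule certificate_complexity_at_le_hitting_set)
  ultimately show ?thesis using x by linarith
qed

theorem mainTheorem8:
  fixes f :: "('n::finite \<Rightarrow> bool) \<Rightarrow> bool"
  shows "real (certificate_complexity f) \<le> (EC f)\<^sup>2"
proof -
  \<comment> \<open>Taking roots gives one lower bound for all feasible objective values, so it
    passes to the infimum without showing that an optimal \<open>w\<close> exists. Nonnegativity of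
    each objective allows the root to be taken.\<close>
  have "sqrt (real (certificate_complexity f)) \<le> EC f"
    unfolding EC_def
  proof (rule cInf_greatest[OF EC_values_nonempty])
    fix v assume "v \<in> EC_objective ` {w. EC_feasible f w}"
    then show "sqrt (real (certificate_complexity f)) \<le> v"
      using certificate_complexity_le_EC_objective_squared EC_objective_nonneg
      by (auto intro!: real_le_lsqrt)
  qed
  then show ?thesis by (rule sqrt_le_D)
qed

end
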